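(* Let $G=(V,E)$ be a finite graph with maximum degree at most $\Delta$. Then $C(I_3(G))\leq \Delta+2$ if $\Delta$ is even, and $C(I_3(G))\leq \Delta+1$ if $\Delta$ is odd.
   Context: Graphs are finite, simple and undirected. For a graph $G=(V,E)$ and an integer $n\geq 1$, $I_n(G)$ is the simplicial complex $\{U\subseteq V:\ \alpha(G[U])<n\}$, where $\alpha$ is the independence number. For a finite simplicial complex $X$, a face $\sigma$ contained in a unique maximal face $\tau$ is a free face; if $|\sigma|\leq d$, removing all faces $\eta$ with $\sigma\subseteq\eta\subseteq\tau$ is an elementary $d$-collapse. $X$ is $d$-collapsible if a sequence of elementary $d$-collapses reduces it to the void complex (no faces at all). $C(X)$ is the minimum $d$ such that $X$ is $d$-collapsible. *)

theory Defs
  imports "Graph_Theory.Digraph_Component"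
begin

text \<open>Finite simple undirected graphs are the locale \<^locale>\<open>graph\<close>: finite symmetric digraphs
  without loops and parallel arcs. Every edge is a pair of opposite arcs, so the degree of a
  vertex is its \<^const>\<open>out_degree\<close>.\<close>

text \<open>The inserted 0 only matters for the graph without vertices.\<close>

definition max_degree :: "('a, 'b) pre_digraph \<Rightarrow> nat" where
  "max_degree G = Max (insert 0 (out_degree G ` verts G))"

definition indep_set :: "('a, 'b) pre_digraph \<Rightarrow> 'a set \<Rightarrow> bool" where
  "indep_set G S \<longleftrightarrow> S \<subseteq> verts G \<and> (\<forall>u\<in>S. \<forall>v\<in>S. \<not> u \<rightarrow>\<^bsub>G\<^esub> v)"

definition independence_number :: "('a, 'b) pre_digraph \<Rightarrow> nat" where
  "independence_number G = Max (card ` {S. indep_set G S})"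

definition indep_complex :: "nat \<Rightarrow> ('a, 'b) pre_digraph \<Rightarrow> 'a set set" where
  "indep_complex n G = {U. U \<subseteq> verts G \<and> independence_number (G \<restriction> U) < n}"

text \<open>A simplicial complex is given by the set of its faces. The void complex is \<^term>\<open>{}\<close>; the
  complex \<^term>\<open>{{}}\<close> with the empty face only is a different one.\<close>

definition maximal_face :: "'a set set \<Rightarrow> 'a set \<Rightarrow> bool" where
  "maximal_face X \<tau> \<longleftrightarrow> \<tau> \<in> X \<and> (\<forall>\<eta>\<in>X. \<tau> \<subseteq> \<eta> \<longrightarrow> \<eta> = \<tau>)"

text \<open>\<open>free_face X \<sigma> \<tau>\<close>: \<open>\<tau>\<close> is the unique maximal face of \<open>X\<close> that contains the face \<open>\<sigma>\<close>.
  The case \<open>\<sigma> = \<tau>\<close> is allowed.\<close>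

definition free_face :: "'a set set \<Rightarrow> 'a set \<Rightarrow> 'a set \<Rightarrow> bool" where
  "free_face X \<sigma> \<tau> \<longleftrightarrow> \<sigma> \<in> X \<and> maximal_face X \<tau> \<and> \<sigma> \<subseteq> \<tau> \<and>
     (\<forall>\<tau>'. maximal_face X \<tau>' \<and> \<sigma> \<subseteq> \<tau>' \<longrightarrow> \<tau>' = \<tau>)"

definition elementary_collapse :: "nat \<Rightarrow> 'a set set \<Rightarrow> 'a set set \<Rightarrow> bool" where
  "elementary_collapse d X Y \<longleftrightarrow>
     (\<exists>\<sigma> \<tau>. free_face X \<sigma> \<tau> \<and> card \<sigma> \<le> d \<and> Y = X - {\<eta>. \<sigma> \<subseteq> \<eta> \<and> \<eta> \<subseteq> \<tau>})"

definition collapsible :: "nat \<Rightarrow> 'a set set \<Rightarrow> bool" where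
  "collapsible d X \<longleftrightarrow> (elementary_collapse d)\<^sup>*\<^sup>* X {}"

text \<open>The minimum exists for every finite complex, see \<open>collapsible_collapsibility\<close> below.\<close>

definition collapsibility :: "'a set set \<Rightarrow> nat" where
  "collapsibility X = (LEAST d. collapsible d X)"

lemma collapsible_exists:
  assumes "finite X" "\<And>\<sigma>. \<sigma> \<in> X \<Longrightarrow> card \<sigma> \<le> d"
  shows "collapsible d X"
  using assms
proof (induction X rule: finite_psubset_induct)
  case (psubset X)
  show ?case
  proof (cases "X = {}")
    case True
    then show ?thesis by (simp add: collapsible_def)
  next
    case False
    then obtain \<tau> where \<tau>: "\<tau> \<in> X" "\<And>\<eta>. \<eta> \<in> X \<Longrightarrow> \<tau> \<subseteq> \<eta> \<Longrightarrow> \<eta> = \<tau>"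
      using finite_has_maximal[OF \<open>finite X\<close>] by blast
    have "free_face X \<tau> \<tau>"
      using \<tau> by (auto simp: free_face_def maximal_face_def)
    moreover have "{\<eta>. \<tau> \<subseteq> \<eta> \<and> \<eta> \<subseteq> \<tau>} = {\<tau>}" by auto
    ultimately have "elementary_collapse d X (X - {\<tau>})"
      unfolding elementary_collapse_def using psubset.prems[OF \<tau>(1)]
      by (intro exI[of _ \<tau>]) simp
    moreover have "collapsible d (X - {\<tau>})"
    proof (rule psubset.IH)
      show "X - {\<tau>} \<subset> X" using \<tau>(1) by blast
      show "card \<sigma> \<le> d" if "\<sigma> \<in> X - {\<tau>}" for \<sigma>
        using that psubset.prems by simp
    qed
    ultimately show ?thesis
      unfolding collapsible_def by (rule converse_rtranclp_into_rtranclp)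
  qed
qed

lemma collapsible_collapsibility:
  assumes "finite X"
  shows "collapsible (collapsibility X) X"
  unfolding collapsibility_def
proof (rule LeastI)
  show "collapsible (Max (card ` X)) X"
    using assms by (intro collapsible_exists) simp_all
qed

lemma finite_indep_sets: "finite (verts G) \<Longrightarrow> finite {S. indep_set G S}"
  by (rule finite_subset[of _ "Pow (verts G)"]) (auto simp: indep_set_def)

lemma indep_complex_downward_closed:
  assumes "finite (verts G)" "U \<in> indep_complex n G" "W \<subseteq> U"
  shows "W \<in> indep_complex n G"
proof -
  have U: "U \<subseteq> verts G" "independence_number (G \<restriction> U) < n"
    using assms(2) by (auto simp: indep_complex_def)
  have fin: "finite {S. indep_set (G \<restriction> U) S}"
    using finite_subset[OF U(1) assms(1)] by (simp add: finite_indep_sets)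
  have "indep_set (G \<restriction> W) {}" by (simp add: indep_set_def)
  moreover have "{S. indep_set (G \<restriction> W) S} \<subseteq> {S. indep_set (G \<restriction> U) S}"
  proof -
    have "u \<rightarrow>\<^bsub>G \<restriction> W\<^esub> v" if "u \<in> W" "v \<in> W" "u \<rightarrow>\<^bsub>G \<restriction> U\<^esub> v" for u v
      using that by (auto simp: arcs_ends_conv)
    then show ?thesis
      using \<open>W \<subseteq> U\<close> unfolding indep_set_def by (simp add: subset_eq) meson
  qed
  ultimately have "independence_number (G \<restriction> W) \<le> independence_number (G \<restriction> U)"
    unfolding independence_number_def using fin by (intro Max_mono image_mono) auto
  then show ?thesis
    using U \<open>W \<subseteq> U\<close> by (auto simp: indep_complex_def)
qed

end

theory Submission
  imports Defs
begin

text \<open>A complex is \<open>(d + 1)\<close>-collapsible if the deletion of some vertex is and its link is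
  \<open>d\<close>-collapsible, so a flag complex on \<open>n\<close> vertices is \<open>\<lfloor>n/2\<rfloor>\<close>-collapsible. Let all degrees be at
  most \<open>2k + 1\<close>. Splitting off \<open>u\<close>, and then one after another the non-neighbours \<open>v\<close> of \<open>u\<close>, it
  suffices that the links of the non-edges \<open>{u, v}\<close> are \<open>2k\<close>-collapsible. Such a link lives on
  \<open>A = N(u) - N(v)\<close>, \<open>B = N(v) - N(u)\<close> and \<open>C = N(u) \<inter> N(v)\<close>, and becomes a flag complex on
  \<open>A \<union> B\<close> after splitting off \<open>C\<close>; this gives the bound \<open>\<lfloor>(|A| + |B|)/2\<rfloor> + |C|\<close>, which is good
  enough unless \<open>|A| + |C| = |B| + |C| = 2k + 1\<close>. In that case a failure forces that flag complex to
  be the boundary of a cross polytope, and counting degrees then shows that \<open>A\<close> is a clique. As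
  \<open>A\<close> cannot be a clique for every non-neighbour of \<open>u\<close>, a good \<open>v\<close> can always be chosen.\<close>

section \<open>Collapsing\<close>

text \<open>A face through \<open>v\<close> lies only in faces through \<open>v\<close>, so
  maximality there is decided by \<open>Y\<close> alone. \<open>Z\<close> is left arbitrary: it is
  the deletion of \<open>v\<close> in one application, and \<open>Y\<close> itself, which gives a
  cone, in the other.\<close>

lemma maximal_face_join_iff:
  assumes "\<forall>\<sigma>\<in>Y. v \<notin> \<sigma>" "\<forall>\<sigma>\<in>Z. v \<notin> \<sigma>"
  shows "maximal_face (Z \<union> insert v ` Y) \<mu> \<and> v \<in> \<mu> \<longleftrightarrow>
    (\<exists>\<tau>. \<mu> = insert v \<tau> \<and> maximal_face Y \<tau>)"
proof
  assume L: "maximal_face (Z \<union> insert v ` Y) \<mu> \<and> v \<in> \<mu>"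
  then obtain \<tau> where \<tau>: "\<tau> \<in> Y" "\<mu> = insert v \<tau>"
    using assms by (auto simp: maximal_face_def)
  have "\<eta> = \<tau>" if "\<eta> \<in> Y" "\<tau> \<subseteq> \<eta>" for \<eta>
  proof -
    have "insert v \<eta> = insert v \<tau>"
      using L that \<tau> unfolding maximal_face_def by blast
    then show ?thesis using assms \<tau> that by (metis insert_ident)
  qed
  then show "\<exists>\<tau>. \<mu> = insert v \<tau> \<and> maximal_face Y \<tau>"
    using \<tau> by (auto simp: maximal_face_def)
next
  assume "\<exists>\<tau>. \<mu> = insert v \<tau> \<and> maximal_face Y \<tau>"
  then obtain \<tau> where \<tau>: "\<mu> = insert v \<tau>" "\<tau> \<in> Y" "\<And>\<eta>. \<eta> \<in> Y \<Longrightarrow> \<tau> \<subseteq> \<eta> \<Longrightarrow> \<eta> = \<tau>"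
    by (auto simp: maximal_face_def)
  have "\<eta> = \<mu>" if "\<eta> \<in> Z \<union> insert v ` Y" "\<mu> \<subseteq> \<eta>" for \<eta>
  proof -
    have "\<eta> \<in> insert v ` Y" using that \<tau>(1) assms(2) by blast
    then obtain \<eta>' where \<eta>': "\<eta>' \<in> Y" "\<eta> = insert v \<eta>'" by blast
    have "\<tau> \<subseteq> \<eta>'" using that \<eta>' \<tau> assms by (metis subset_insert_iff insert_subset)
    then show ?thesis using \<tau> \<eta>' by auto
  qed
  then show "maximal_face (Z \<union> insert v ` Y) \<mu> \<and> v \<in> \<mu>"
    using \<tau> by (auto simp: maximal_face_def)
qed

text \<open>A collapse of the link lifts by adding \<open>v\<close> to the free face and to its
  maximal face. The added vertex is what raises \<open>d\<close> by one; faces in \<open>Z\<close>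
  are not touched.\<close>

lemma elementary_collapse_join:
  assumes "elementary_collapse d Y Y'" "\<forall>\<sigma>\<in>Y. v \<notin> \<sigma>" "\<forall>\<sigma>\<in>Z. v \<notin> \<sigma>"
  shows "elementary_collapse (Suc d) (Z \<union> insert v ` Y) (Z \<union> insert v ` Y')"
proof -
  obtain \<sigma> \<tau> where *: "free_face Y \<sigma> \<tau>" "card \<sigma> \<le> d" "Y' = Y - {\<eta>. \<sigma> \<subseteq> \<eta> \<and> \<eta> \<subseteq> \<tau>}"
    using assms(1) unfolding elementary_collapse_def by blast
  have mem: "\<sigma> \<in> Y" "maximal_face Y \<tau>" "\<sigma> \<subseteq> \<tau>" "\<tau> \<in> Y" "v \<notin> \<sigma>" "v \<notin> \<tau>"
    using * assms by (auto simp: free_face_def maximal_face_def)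
  have uniq: "\<tau>' = \<tau>" if "maximal_face Y \<tau>'" "\<sigma> \<subseteq> \<tau>'" for \<tau>'
    using * that by (auto simp: free_face_def)
  have "free_face (Z \<union> insert v ` Y) (insert v \<sigma>) (insert v \<tau>)"
    unfolding free_face_def
  proof (intro conjI allI impI)
    show "maximal_face (Z \<union> insert v ` Y) (insert v \<tau>)"
      using maximal_face_join_iff[OF assms(2,3)] mem by blast
    fix \<mu> assume "maximal_face (Z \<union> insert v ` Y) \<mu> \<and> insert v \<sigma> \<subseteq> \<mu>"
    then obtain \<tau>' where "\<mu> = insert v \<tau>'" "maximal_face Y \<tau>'" "insert v \<sigma> \<subseteq> \<mu>"
      using maximal_face_join_iff[OF assms(2,3)] by blast
    then show "\<mu> = insert v \<tau>" using uniq mem by blast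
  qed (use mem in auto)
  moreover have "card (insert v \<sigma>) \<le> Suc d"
    using *(2) by (metis card_insert_le_m1 diff_Suc_1 zero_less_Suc)
  moreover have "Z \<union> insert v ` Y' = (Z \<union> insert v ` Y) - {\<eta>. insert v \<sigma> \<subseteq> \<eta> \<and> \<eta> \<subseteq> insert v \<tau>}"
  proof -
    have "insert v \<sigma> \<subseteq> insert v \<eta> \<and> insert v \<eta> \<subseteq> insert v \<tau> \<longleftrightarrow> \<sigma> \<subseteq> \<eta> \<and> \<eta> \<subseteq> \<tau>" if "\<eta> \<in> Y" for \<eta>
      using that mem assms(2) by blast
    then show ?thesis using assms(3) unfolding *(3) by auto
  qed
  ultimately show ?thesis unfolding elementary_collapse_def by blast
qed

lemma collapsible_link_deletion:
  assumes "collapsible d Y" "collapsible (Suc d) Z" "\<forall>\<sigma>\<in>Y. v \<notin> \<sigma>" "\<forall>\<sigma>\<in>Z. v \<notin> \<sigma>"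
  shows "collapsible (Suc d) (Z \<union> insert v ` Y)"
proof -
  have "(elementary_collapse (Suc d))\<^sup>*\<^sup>* (Z \<union> insert v ` Y) Z"
    using assms(1,3) unfolding collapsible_def
  proof (induction rule: converse_rtranclp_induct)
    case (step Y Y')
    moreover have "\<forall>\<sigma>\<in>Y'. v \<notin> \<sigma>"
      using step by (auto simp: elementary_collapse_def)
    ultimately show ?case
      using elementary_collapse_join[OF _ _ assms(4)] by (metis converse_rtranclp_into_rtranclp)
  qed simp
  then show ?thesis using assms(2) unfolding collapsible_def by simp
qed

text \<open>In a cone \<open>\<sigma>\<close> itself remains free, since every maximal face contains
  the apex \<open>v\<close>. The removed interval takes \<open>\<eta>\<close> and
  \<open>insert v \<eta>\<close> together, so \<open>d\<close> does not grow.\<close>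

lemma elementary_collapse_cone:
  assumes "elementary_collapse d Y Y'" "\<forall>\<sigma>\<in>Y. v \<notin> \<sigma>"
  shows "elementary_collapse d (Y \<union> insert v ` Y) (Y' \<union> insert v ` Y')"
proof -
  obtain \<sigma> \<tau> where *: "free_face Y \<sigma> \<tau>" "card \<sigma> \<le> d" "Y' = Y - {\<eta>. \<sigma> \<subseteq> \<eta> \<and> \<eta> \<subseteq> \<tau>}"
    using assms(1) unfolding elementary_collapse_def by blast
  have mem: "\<sigma> \<in> Y" "maximal_face Y \<tau>" "\<sigma> \<subseteq> \<tau>" "\<tau> \<in> Y" "v \<notin> \<sigma>" "v \<notin> \<tau>"
    using * assms by (auto simp: free_face_def maximal_face_def)
  have uniq: "\<tau>' = \<tau>" if "maximal_face Y \<tau>'" "\<sigma> \<subseteq> \<tau>'" for \<tau>'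
    using * that by (auto simp: free_face_def)
  have "free_face (Y \<union> insert v ` Y) \<sigma> (insert v \<tau>)"
    unfolding free_face_def
  proof (intro conjI allI impI)
    show "maximal_face (Y \<union> insert v ` Y) (insert v \<tau>)"
      using maximal_face_join_iff[OF assms(2,2)] mem by blast
    fix \<mu> assume \<mu>: "maximal_face (Y \<union> insert v ` Y) \<mu> \<and> \<sigma> \<subseteq> \<mu>"
    have "v \<in> \<mu>"
    proof (rule ccontr)
      assume "v \<notin> \<mu>"
      then have "\<mu> \<in> Y" using \<mu> by (auto simp: maximal_face_def)
      then have "insert v \<mu> = \<mu>" using \<mu> unfolding maximal_face_def by blast
      then show False using \<open>v \<notin> \<mu>\<close> by auto
    qed
    then obtain \<tau>' where "\<mu> = insert v \<tau>'" "maximal_face Y \<tau>'"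
      using maximal_face_join_iff[OF assms(2,2)] \<mu> by blast
    then show "\<mu> = insert v \<tau>" using uniq mem \<mu> by (metis subset_insert)
  qed (use mem in auto)
  moreover have "Y' \<union> insert v ` Y' = (Y \<union> insert v ` Y) - {\<eta>. \<sigma> \<subseteq> \<eta> \<and> \<eta> \<subseteq> insert v \<tau>}"
  proof -
    have "\<sigma> \<subseteq> insert v \<eta> \<and> insert v \<eta> \<subseteq> insert v \<tau> \<longleftrightarrow> \<sigma> \<subseteq> \<eta> \<and> \<eta> \<subseteq> \<tau>"
      "\<sigma> \<subseteq> \<eta> \<and> \<eta> \<subseteq> insert v \<tau> \<longleftrightarrow> \<sigma> \<subseteq> \<eta> \<and> \<eta> \<subseteq> \<tau>" if "\<eta> \<in> Y" for \<eta>
      using that mem assms(2) by blast+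
    then show ?thesis unfolding *(3) by auto
  qed
  ultimately show ?thesis using *(2) unfolding elementary_collapse_def by blast
qed

lemma collapsible_cone:
  assumes "collapsible d Y" "\<forall>\<sigma>\<in>Y. v \<notin> \<sigma>"
  shows "collapsible d (Y \<union> insert v ` Y)"
  using assms unfolding collapsible_def
proof (induction rule: converse_rtranclp_induct)
  case (step Y Y')
  moreover have "\<forall>\<sigma>\<in>Y'. v \<notin> \<sigma>"
    using step by (auto simp: elementary_collapse_def)
  ultimately show ?case
    using elementary_collapse_cone by (metis converse_rtranclp_into_rtranclp)
qed simp

lemma collapsible_mono:
  assumes "collapsible d X" "d \<le> d'"
  shows "collapsible d' X"
proof -
  have "elementary_collapse d \<le> elementary_collapse d'"
    using assms(2) unfolding elementary_collapse_def by (auto intro: le_trans)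
  then show ?thesis
    using assms(1) rtranclp_mono unfolding collapsible_def by blast
qed

lemma collapsible_void [simp]: "collapsible d {}"
  by (simp add: collapsible_def)

lemma collapsible_card:
  assumes "finite V" "X \<subseteq> Pow V"
  shows "collapsible (card V) X"
  using assms by (intro collapsible_exists) (auto intro: finite_subset card_mono)

section \<open>Flag complexes\<close>

text \<open>\<open>P\<close> is the relation of missing edges. The case \<open>x = y\<close> is
  included on purpose: \<open>P x x\<close> says that \<open>x\<close> is not a vertex of the
  complex, as can happen in links.\<close>

definition flag_complex :: "('a \<Rightarrow> 'a \<Rightarrow> bool) \<Rightarrow> 'a set \<Rightarrow> 'a set set" where
  "flag_complex P V = {U. U \<subseteq> V \<and> (\<forall>x\<in>U. \<forall>y\<in>U. \<not> P x y)}"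

lemma flag_complex_cone:
  assumes "collapsible d (flag_complex P V)" "x \<notin> V" "\<not> P x x" "\<And>y. y \<in> V \<Longrightarrow> \<not> P x y"
    "symp P"
  shows "collapsible d (flag_complex P (insert x V))"
proof -
  have "flag_complex P (insert x V) = flag_complex P V \<union> insert x ` flag_complex P V"
  proof (intro set_eqI iffI)
    fix U assume U: "U \<in> flag_complex P (insert x V)"
    show "U \<in> flag_complex P V \<union> insert x ` flag_complex P V"
    proof (cases "x \<in> U")
      case True
      have "U - {x} \<in> flag_complex P V" using U by (auto simp: flag_complex_def)
      then have "insert x (U - {x}) \<in> flag_complex P V \<union> insert x ` flag_complex P V" by (intro UnI2 imageI)
      then show ?thesis using True by (simp add: insert_absorb)
    next
      case False
      then show ?thesis using U by (auto simp: flag_complex_def)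
    qed
  next
    fix U assume "U \<in> flag_complex P V \<union> insert x ` flag_complex P V"
    then show "U \<in> flag_complex P (insert x V)"
      using assms by (auto simp: flag_complex_def dest: sympD)
  qed
  moreover have "\<forall>\<sigma>\<in>flag_complex P V. x \<notin> \<sigma>" using assms(2) by (auto simp: flag_complex_def)
  ultimately show ?thesis using collapsible_cone[OF assms(1)] by simp
qed

lemma flag_complex_not_vertex:
  assumes "P x x" shows "flag_complex P (insert x V) = flag_complex P V"
  using assms by (auto simp: flag_complex_def)

lemma flag_complex_link_deletion:
  assumes "collapsible (Suc d) (flag_complex P V)" "collapsible d (flag_complex P {y \<in> V. \<not> P x y})"
    "x \<notin> V" "\<not> P x x" "symp P"
  shows "collapsible (Suc d) (flag_complex P (insert x V))"
proof -
  let ?L = "flag_complex P {y \<in> V. \<not> P x y}"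
  have "flag_complex P (insert x V) = flag_complex P V \<union> insert x ` ?L"
  proof (intro set_eqI iffI)
    fix U assume U: "U \<in> flag_complex P (insert x V)"
    show "U \<in> flag_complex P V \<union> insert x ` ?L"
    proof (cases "x \<in> U")
      case True
      have "U - {x} \<in> ?L" using U True by (auto simp: flag_complex_def)
      then have "insert x (U - {x}) \<in> flag_complex P V \<union> insert x ` ?L" by (intro UnI2 imageI)
      then show ?thesis using True by (simp add: insert_absorb)
    next
      case False
      then show ?thesis using U by (auto simp: flag_complex_def)
    qed
  next
    fix U assume "U \<in> flag_complex P V \<union> insert x ` ?L"
    then show "U \<in> flag_complex P (insert x V)"
      using assms by (auto simp: flag_complex_def dest: sympD)
  qed
  moreover have "\<forall>\<sigma>\<in>flag_complex P V. x \<notin> \<sigma>" "\<forall>\<sigma>\<in>?L. x \<notin> \<sigma>"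
    using assms(3) by (auto simp: flag_complex_def)
  ultimately show ?thesis using collapsible_link_deletion[OF assms(2,1)] by simp
qed

text \<open>The complex is a join, as no pair between \<open>A\<close> and \<open>B\<close> is
  missing; hence \<open>B\<close> stays intact in every link. In the link of \<open>x\<close>, both
  \<open>x\<close> and some \<open>y\<close> with \<open>P x y\<close> disappear, so a cost of one
  pays for two vertices of \<open>A\<close>. A vertex without such a \<open>y\<close> is a cone
  point and costs nothing.\<close>

lemma collapsible_flag_complex_Un:
  assumes "finite A" "collapsible j (flag_complex P B)" "card A \<le> Suc (2 * i)" "A \<inter> B = {}"
    "\<And>x y. x \<in> A \<Longrightarrow> y \<in> B \<Longrightarrow> \<not> P x y" "symp P"
  shows "collapsible (i + j) (flag_complex P (A \<union> B))"
  using assms(1,3-5)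
proof (induction "card A" arbitrary: A i rule: less_induct)
  case less
  show ?case
  proof (cases "A = {}")
    case True
    then show ?thesis using assms(2) by (simp add: collapsible_mono)
  next
    case False
    then obtain x where "x \<in> A" by blast
    define A' where "A' = A - {x}"
    have A: "A = insert x A'" "x \<notin> A'" "x \<notin> B" "finite A'"
      using \<open>x \<in> A\<close> less.prems by (auto simp: A'_def)
    then have cardA: "card A = Suc (card A')" by simp
    have del: "collapsible (i' + j) (flag_complex P (A' \<union> B))" if "card A' \<le> Suc (2 * i')" for i'
      using less.hyps[of A' i'] less.prems A that by auto
    consider (dead) "P x x" | (cone) "\<not> P x x" "\<forall>y\<in>A'. \<not> P x y" | (link) y where "\<not> P x x" "y \<in> A'" "P x y"
      by blast
    then show ?thesis
    proof cases
      case dead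
      then show ?thesis
        using del[of i] less.prems A flag_complex_not_vertex[of P x "A' \<union> B"] by simp
    next
      case cone
      have "collapsible (i + j) (flag_complex P (insert x (A' \<union> B)))"
        using cone del[of i] less.prems(2,4) A assms(6) by (intro flag_complex_cone) auto
      then show ?thesis using A by simp
    next
      case link
      let ?L = "{z \<in> A'. \<not> P x z}"
      have "card ?L < card A'" using link A by (intro psubset_card_mono) auto
      then obtain i' where i': "i = Suc i'"
        using less.prems(2) cardA by (cases i) auto
      have "collapsible (i' + j) (flag_complex P (?L \<union> B))"
      proof (rule less.hyps)
        show "card ?L < card A" "card ?L \<le> Suc (2 * i')"
          using \<open>card ?L < card A'\<close> cardA i' less.prems(2) by linarith+
        show "?L \<inter> B = {}" using A(1) less.prems(3) by blast
        show "\<not> P z y" if "z \<in> ?L" "y \<in> B" for z y using that A(1) less.prems(4) by blast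
      qed (use A in simp)
      moreover have "?L \<union> B = {z \<in> A' \<union> B. \<not> P x z}"
        using less.prems(4) \<open>x \<in> A\<close> by auto
      ultimately have "collapsible (Suc (i' + j)) (flag_complex P (insert x (A' \<union> B)))"
        using del[of "Suc i'"] less.prems(2) A cardA i' link assms(6)
        by (intro flag_complex_link_deletion) simp_all
      then show ?thesis using A i' by simp
    qed
  qed
qed

lemma collapsible_flag_complex:
  assumes "finite V" "card V \<le> Suc (2 * i)" "symp P"
  shows "collapsible i (flag_complex P V)"
proof -
  \<comment> \<open>This complex is not void, but a collapse at the empty face, which has size 0,
    removes it; so \<open>j = 0\<close> suffices.\<close>
  have "flag_complex P {} = {{}}" by (auto simp: flag_complex_def)
  then have "collapsible 0 (flag_complex P {})"
    using collapsible_card[of "{}" "{{}}"] by simp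
  then show ?thesis using collapsible_flag_complex_Un[of V 0 P "{}" i] assms by simp
qed

text \<open>The bound of the previous lemma is only attained by boundaries of cross polytopes.\<close>

lemma collapsible_flag_complex_or_matching:
  assumes "finite V" "card V \<le> 2 * Suc i" "symp P"
  shows "collapsible i (flag_complex P V) \<or>
    (\<forall>x\<in>V. \<not> P x x \<and> (\<exists>!y. y \<in> V \<and> P x y))"
proof (rule disjCI)
  assume "\<not> (\<forall>x\<in>V. \<not> P x x \<and> (\<exists>!y. y \<in> V \<and> P x y))"
  then obtain x where x: "x \<in> V" "P x x \<or> \<not> (\<exists>!y. y \<in> V \<and> P x y)" by blast
  define V' where "V' = V - {x}"
  have V: "V = insert x V'" "x \<notin> V'" "finite V'"
    using x(1) assms by (auto simp: V'_def)
  then have cardV: "card V = Suc (card V')" by simp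
  have del: "collapsible i (flag_complex P V')"
    using V assms by (intro collapsible_flag_complex) auto
  consider (dead) "P x x" | (cone) "\<not> P x x" "\<forall>y\<in>V'. \<not> P x y"
    | (link) y z where "\<not> P x x" "y \<in> V'" "P x y" "z \<in> V'" "P x z" "y \<noteq> z"
    using x V by blast
  then show "collapsible i (flag_complex P V)"
  proof cases
    case dead
    then show ?thesis using del V(1) flag_complex_not_vertex[of P x V'] by simp
  next
    case cone
    then show ?thesis using flag_complex_cone[OF del V(2) _ _ assms(3)] V(1) by simp
  next
    case link
    \<comment> \<open>Besides \<open>x\<close>, both \<open>y\<close> and \<open>z\<close> are gone
      from the link, which leaves at most \<open>Suc (2 * i')\<close> vertices where
      \<open>i = Suc i'\<close>. A single partner could leave one vertex too many.\<close>
    let ?L = "{y \<in> V'. \<not> P x y}"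
    have "card ?L \<le> card (V' - {y, z})" using link V by (intro card_mono) auto
    also have "\<dots> = card V' - 2" using link by (subst card_Diff_subset) auto
    finally have le: "card ?L \<le> card V' - 2" .
    have "card {y, z} \<le> card V'" using link V by (intro card_mono) auto
    then have "2 \<le> card V'" using link by simp
    then obtain i' where i': "i = Suc i'"
      using cardV assms(2) by (cases i) auto
    have "collapsible i' (flag_complex P ?L)"
      using le \<open>2 \<le> card V'\<close> V(3) cardV assms i' by (intro collapsible_flag_complex) auto
    then show ?thesis
      using flag_complex_link_deletion[OF del[unfolded i'] _ V(2) link(1) assms(3)] V(1) i' by simp
  qed
qed

section \<open>Links in the complex of sets without independent triples\<close>

locale symmetric_relation =
  fixes E :: "'a \<Rightarrow> 'a \<Rightarrow> bool"
  assumes sym: "E x y \<Longrightarrow> E y x"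
begin

definition triple_free :: "'a set \<Rightarrow> bool" where
  "triple_free U \<longleftrightarrow> (\<forall>x\<in>U. \<forall>y\<in>U. \<forall>z\<in>U. x \<noteq> y \<and> y \<noteq> z \<and> x \<noteq> z \<longrightarrow> E x y \<or> E y z \<or> E x z)"

text \<open>For \<open>W\<close> disjoint from \<open>S\<close> this is the link of \<open>S\<close>
  in the complex of triple-free subsets of \<open>S \<union> W\<close>. Deleting a vertex shrinks
  \<open>W\<close>, and taking its link moves it from \<open>W\<close> to \<open>S\<close>. The
  result is void if \<open>S\<close> is not triple-free.\<close>

definition link_complex :: "'a set \<Rightarrow> 'a set \<Rightarrow> 'a set set" where
  "link_complex S W = {U. U \<subseteq> W \<and> triple_free (S \<union> U)}"

lemma triple_freeD:
  assumes "triple_free U" "x \<in> U" "y \<in> U" "z \<in> U" "x \<noteq> y" "y \<noteq> z" "x \<noteq> z"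
  shows "E x y \<or> E y z \<or> E x z"
  using assms unfolding triple_free_def by blast

lemma triple_free_subset: "triple_free U \<Longrightarrow> U' \<subseteq> U \<Longrightarrow> triple_free U'"
  unfolding triple_free_def by blast

lemma link_complex_insert:
  assumes "x \<notin> W"
  shows "link_complex S (insert x W) = link_complex S W \<union> insert x ` link_complex (insert x S) W"
proof (intro set_eqI iffI)
  fix U assume U: "U \<in> link_complex S (insert x W)"
  show "U \<in> link_complex S W \<union> insert x ` link_complex (insert x S) W"
  proof (cases "x \<in> U")
    case True
    then have "insert x S \<union> (U - {x}) = S \<union> U" by auto
    then have "U - {x} \<in> link_complex (insert x S) W" using U by (auto simp: link_complex_def)
    then have "insert x (U - {x}) \<in> link_complex S W \<union> insert x ` link_complex (insert x S) W" by (intro UnI2 imageI)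
      then show ?thesis using True by (simp add: insert_absorb)
  next
    case False
    then show ?thesis using U by (auto simp: link_complex_def)
  qed
next
  fix U assume "U \<in> link_complex S W \<union> insert x ` link_complex (insert x S) W"
  then show "U \<in> link_complex S (insert x W)" by (auto simp: link_complex_def)
qed

lemma collapsible_link_complex_insert:
  assumes "collapsible d (link_complex (insert x S) W)" "collapsible (Suc d) (link_complex S W)" "x \<notin> W"
  shows "collapsible (Suc d) (link_complex S (insert x W))"
  unfolding link_complex_insert[OF assms(3)]
  using assms by (intro collapsible_link_deletion) (auto simp: link_complex_def)

lemma collapsible_link_complex_cone:
  assumes "link_complex (insert x S) W = link_complex S W" "collapsible d (link_complex S W)" "x \<notin> W"
  shows "collapsible d (link_complex S (insert x W))"
  unfolding link_complex_insert[OF assms(3)] assms(1)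
  using assms by (intro collapsible_cone) (auto simp: link_complex_def)

text \<open>Each vertex of \<open>W\<close> is adjacent to exactly one of \<open>u\<close> and \<open>v\<close>, so two of the vertices of
  an independent triple in \<open>W\<close> form one with \<open>u\<close> or \<open>v\<close>.\<close>

lemma link_complex_eq_flag_complex:
  assumes "u \<in> S" "v \<in> S" "u \<noteq> v" "W \<inter> S = {}" "\<And>x. x \<in> W \<Longrightarrow> E u x \<noteq> E v x" "triple_free S"
  shows "link_complex S W = flag_complex (\<lambda>x y. \<not> triple_free (S \<union> {x, y})) W"
proof (intro set_eqI iffI)
  fix U assume "U \<in> link_complex S W"
  then show "U \<in> flag_complex (\<lambda>x y. \<not> triple_free (S \<union> {x, y})) W"
    by (auto simp: link_complex_def flag_complex_def intro: triple_free_subset)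
next
  fix U assume "U \<in> flag_complex (\<lambda>x y. \<not> triple_free (S \<union> {x, y})) W"
  then have U: "U \<subseteq> W" "\<And>x y. x \<in> U \<Longrightarrow> y \<in> U \<Longrightarrow> triple_free (S \<union> {x, y})"
    by (auto simp: flag_complex_def)
  have u: "E u x \<or> E u y \<or> E x y" "E v x \<or> E v y \<or> E x y" if "x \<in> U" "y \<in> U" "x \<noteq> y" for x y
  proof -
    have "x \<notin> S" "y \<notin> S" using that U(1) assms(4) by auto
    then have "u \<noteq> x" "u \<noteq> y" "v \<noteq> x" "v \<noteq> y" using assms(1,2) by auto
    then show "E u x \<or> E u y \<or> E x y" "E v x \<or> E v y \<or> E x y"
      using triple_freeD[OF U(2)[OF that(1,2)], of u x y] triple_freeD[OF U(2)[OF that(1,2)], of v x y]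
        assms(1,2) that(3) by auto
  qed
  \<comment> \<open>For triples that meet \<open>S\<close>: the other two vertices lie, together
    with all of \<open>S\<close>, in a set known to be triple-free.\<close>
  have pairs: "\<exists>X. triple_free X \<and> S \<subseteq> X \<and> x \<in> X \<and> y \<in> X" if "x \<in> S \<union> U" "y \<in> S \<union> U" for x y
  proof (cases "x \<in> S \<or> y \<in> S")
    case True
    define z where "z = (if x \<in> S then y else x)"
    have z: "x \<in> S \<union> {z}" "y \<in> S \<union> {z}" "z \<in> S \<union> U" using True that by (auto simp: z_def)
    then have "triple_free (S \<union> {z})"
      using U(2)[of z z] assms(6) by (cases "z \<in> S") (auto simp: insert_absorb)
    then show ?thesis using z by (intro exI[of _ "S \<union> {z}"]) auto
  next
    case False
    then show ?thesis using that U(2)[of x y] by (intro exI[of _ "S \<union> {x, y}"]) auto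
  qed
  have "triple_free (S \<union> U)"
    unfolding triple_free_def
  proof (intro ballI impI)
    fix x y z assume xyz: "x \<in> S \<union> U" "y \<in> S \<union> U" "z \<in> S \<union> U" "x \<noteq> y \<and> y \<noteq> z \<and> x \<noteq> z"
    consider "x \<in> U" "y \<in> U" "z \<in> U" | "x \<in> S" | "y \<in> S" | "z \<in> S"
      using xyz by blast
    then show "E x y \<or> E y z \<or> E x z"
    proof cases
      case 1
      then have "E u x \<noteq> E v x" "E u y \<noteq> E v y" "E u z \<noteq> E v z"
        using assms(5) U(1) by auto
      then show ?thesis
        using u[of x y] u[of y z] u[of x z] 1 xyz(4) by meson
    next
      case 2
      obtain X where "triple_free X" "S \<subseteq> X" "y \<in> X" "z \<in> X" using pairs[of y z] xyz by blast
      then show ?thesis using 2 xyz(4) by (intro triple_freeD[of X]) auto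
    next
      case 3
      obtain X where "triple_free X" "S \<subseteq> X" "x \<in> X" "z \<in> X" using pairs[of x z] xyz by blast
      then show ?thesis using 3 xyz(4) by (intro triple_freeD[of X]) auto
    next
      case 4
      obtain X where "triple_free X" "S \<subseteq> X" "x \<in> X" "y \<in> X" using pairs[of x y] xyz by blast
      then show ?thesis using 4 xyz(4) by (intro triple_freeD[of X]) auto
    qed
  qed
  then show "U \<in> link_complex S W" using U by (simp add: link_complex_def)
qed

lemma symp_not_triple_free: "symp (\<lambda>x y. \<not> triple_free (S \<union> {x, y}))"
  by (simp add: symp_def insert_commute)

lemma collapsible_link_complex_flag:
  assumes "u \<in> S" "v \<in> S" "u \<noteq> v" "W \<inter> S = {}" "\<And>x. x \<in> W \<Longrightarrow> E u x \<noteq> E v x"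
    "finite W" "card W \<le> Suc (2 * i)"
  shows "collapsible i (link_complex S W)"
proof (cases "triple_free S")
  case True
  then show ?thesis
    using collapsible_flag_complex[OF assms(6,7) symp_not_triple_free] link_complex_eq_flag_complex[OF assms(1-5)]
    by simp
next
  case False
  then have "link_complex S W = {}" using triple_free_subset by (auto simp: link_complex_def)
  then show ?thesis by simp
qed

text \<open>Each vertex of \<open>F\<close> is split off at the cost of one. Once \<open>F\<close>
  is exhausted only \<open>W\<close> remains, and there the flag bound \<open>i\<close> holds for
  whatever \<open>S\<close> has become, as \<open>S\<close> still contains \<open>u\<close> and
  \<open>v\<close>.\<close>

lemma collapsible_link_complex_Un:
  assumes "finite F" "u \<in> S" "v \<in> S" "u \<noteq> v" "W \<inter> S = {}" "\<And>x. x \<in> W \<Longrightarrow> E u x \<noteq> E v x"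
    "finite W" "card W \<le> Suc (2 * i)" "F \<inter> S = {}" "F \<inter> W = {}"
  shows "collapsible (i + card F) (link_complex S (F \<union> W))"
  using assms
proof (induction F arbitrary: S)
  case empty
  then show ?case using collapsible_link_complex_flag[of u S v W i] by simp
next
  case (insert x F)
  have "collapsible (i + card F) (link_complex (insert x S) (F \<union> W))"
    using insert by (intro insert.IH) auto
  moreover have "collapsible (Suc (i + card F)) (link_complex S (F \<union> W))"
    using insert by (intro collapsible_mono[OF insert.IH]) auto
  ultimately have "collapsible (Suc (i + card F)) (link_complex S (insert x (F \<union> W)))"
    using insert by (intro collapsible_link_complex_insert) auto
  then show ?case using insert by simp
qed

text \<open>This saves one against the previous bound for \<open>insert w F\<close>. Only the
  innermost link, with all of \<open>F\<close> moved to \<open>S\<close>, has to be good: every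
  deletion on the way loses a vertex of \<open>F\<close>, which pays for \<open>w\<close>.\<close>

lemma collapsible_link_complex_Un_insert:
  assumes "finite F" "u \<in> S" "v \<in> S" "u \<noteq> v" "W \<inter> S = {}" "\<And>x. x \<in> W \<Longrightarrow> E u x \<noteq> E v x"
    "finite W" "card W \<le> Suc (2 * i)" "F \<inter> S = {}" "F \<inter> W = {}" "w \<notin> S" "w \<notin> W" "w \<notin> F"
    "collapsible i (link_complex (S \<union> F) (insert w W))"
  shows "collapsible (i + card F) (link_complex S (insert w (F \<union> W)))"
  using assms
proof (induction F arbitrary: S)
  case empty
  then show ?case by simp
next
  case (insert x F)
  have link: "collapsible (i + card F) (link_complex (insert x S) (insert w (F \<union> W)))"
    using insert by (intro insert.IH) auto
  have del: "collapsible (Suc (i + card F)) (link_complex S (insert w (F \<union> W)))"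
    using insert collapsible_link_complex_Un[of "insert w F" u S v W i] by simp
  have "x \<notin> insert w (F \<union> W)" using insert by auto
  then have "collapsible (Suc (i + card F)) (link_complex S (insert x (insert w (F \<union> W))))"
    by (rule collapsible_link_complex_insert[OF link del])
  moreover have "insert x (insert w (F \<union> W)) = insert w (insert x F \<union> W)" by auto
  ultimately show ?case using insert.hyps by simp
qed

lemma not_triple_free_insertE:
  assumes "\<not> triple_free (insert w X)" "triple_free X"
  obtains x y where "x \<in> X" "y \<in> X" "x \<noteq> y" "x \<noteq> w" "y \<noteq> w" "\<not> E w x" "\<not> E w y" "\<not> E x y"
proof -
  obtain x y z where xyz: "x \<in> insert w X" "y \<in> insert w X" "z \<in> insert w X"
    "x \<noteq> y" "y \<noteq> z" "x \<noteq> z" "\<not> E x y" "\<not> E y z" "\<not> E x z"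
    using assms(1) unfolding triple_free_def by blast
  have "x = w \<or> y = w \<or> z = w"
    using assms(2) xyz triple_freeD[of X x y z] by blast
  then show thesis
    using that[of y z] that[of x z] that[of x y] xyz sym by blast
qed

end

section \<open>The link of a pair of vertices when all degrees are at most 2k + 1\<close>

locale nonadjacent_pair = symmetric_relation E for E :: "'a \<Rightarrow> 'a \<Rightarrow> bool" +
  fixes u v :: 'a and A B C :: "'a set" and k :: nat
  assumes fin: "finite A" "finite B" "finite C"
    and uv: "u \<noteq> v" "u \<notin> A \<union> B \<union> C" "v \<notin> A \<union> B \<union> C"
    and A: "x \<in> A \<Longrightarrow> E u x" "x \<in> A \<Longrightarrow> \<not> E v x"
    and B: "x \<in> B \<Longrightarrow> E v x" "x \<in> B \<Longrightarrow> \<not> E u x"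
    and C: "x \<in> C \<Longrightarrow> E u x" "x \<in> C \<Longrightarrow> E v x"
    and degree: "x \<in> {u, v} \<union> A \<union> B \<union> C \<Longrightarrow>
      card {y \<in> {u, v} \<union> A \<union> B \<union> C. E x y} \<le> Suc (2 * k)"
begin

lemma disj: "A \<inter> B = {}" "A \<inter> C = {}" "B \<inter> C = {}"
  using A B C by blast+

lemma card_AC: "card A + card C \<le> Suc (2 * k)"
proof -
  have "card (A \<union> C) \<le> card {y \<in> {u, v} \<union> A \<union> B \<union> C. E u y}"
    using A C fin by (intro card_mono) auto
  then show ?thesis using degree[of u] disj fin by (simp add: card_Un_disjoint)
qed

lemma card_BC: "card B + card C \<le> Suc (2 * k)"
proof -
  have "card (B \<union> C) \<le> card {y \<in> {u, v} \<union> A \<union> B \<union> C. E v y}"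
    using B C fin by (intro card_mono) auto
  then show ?thesis using degree[of v] disj fin by (simp add: card_Un_disjoint)
qed

lemma card_AB: "card (A \<union> B) = card A + card B"
  using disj fin by (simp add: card_Un_disjoint)

lemma AB: "x \<in> A \<union> B \<Longrightarrow> E u x \<noteq> E v x"
  using A B by auto

lemma collapsible_if_small:
  assumes "card A + card C \<le> 2 * k \<or> card B + card C \<le> 2 * k"
  shows "collapsible (2 * k) (link_complex {u, v} (C \<union> (A \<union> B)))"
proof -
  have "collapsible ((card A + card B) div 2 + card C) (link_complex {u, v} (C \<union> (A \<union> B)))"
    using AB uv fin disj card_AB by (intro collapsible_link_complex_Un[of C u _ v]) auto
  \<comment> \<open>By assumption \<open>card A + card B + 2 * card C\<close> is at most 4k + 1, and
    rounding down absorbs the 1.\<close>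
  moreover have "(card A + card B) div 2 + card C \<le> 2 * k"
    using assms card_AC card_BC by linarith
  ultimately show ?thesis by (rule collapsible_mono)
qed

text \<open>For \<open>x\<close> in \<open>A\<close> and \<open>y\<close> in \<open>B\<close> the
  edges from \<open>u\<close> to \<open>x\<close> and from \<open>v\<close> to \<open>y\<close> meet
  every triple in \<open>{u, v, x, y}\<close> in an edge. So the complex is the join of its parts on
  \<open>A\<close> and on \<open>B\<close>; rounding down on each part separately gives k + k
  instead of 2k + 1.\<close>

lemma collapsible_if_no_common_neighbours:
  assumes "C = {}"
  shows "collapsible (2 * k) (link_complex {u, v} (C \<union> (A \<union> B)))"
proof (cases "triple_free {u, v}")
  case True
  let ?P = "\<lambda>x y. \<not> triple_free ({u, v} \<union> {x, y})"
  have cross: "\<not> ?P x y" if "x \<in> A" "y \<in> B" for x y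
    using that A[of x] B[of y] sym unfolding triple_free_def by blast
  have "collapsible (k + k) (flag_complex ?P (A \<union> B))"
    using card_AC card_BC cross fin disj symp_not_triple_free assms
    by (intro collapsible_flag_complex_Un collapsible_flag_complex) auto
  then show ?thesis
    using link_complex_eq_flag_complex[of u "{u, v}" v "A \<union> B"] uv AB True assms by (simp add: mult_2)
next
  case False
  then have "link_complex {u, v} (C \<union> (A \<union> B)) = {}" using triple_free_subset by (auto simp: link_complex_def)
  then show ?thesis by simp
qed

text \<open>What \<open>{u, v}\<close> has grown to when all of \<open>C\<close> is split off and
  only \<open>A \<union> B\<close> is left.\<close>

definition S :: "'a set" where "S = {u, v} \<union> C"

definition missing_edge :: "'a \<Rightarrow> 'a \<Rightarrow> bool" where "missing_edge x y \<longleftrightarrow> \<not> triple_free (S \<union> {x, y})"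

lemma missing_edgeI:
  assumes "z \<in> S" "\<not> E x y" "\<not> E x z" "\<not> E y z" "x \<noteq> y" "z \<noteq> x" "z \<noteq> y"
  shows "missing_edge x y"
  using assms triple_freeD[of "S \<union> {x, y}" x y z] by (auto simp: missing_edge_def)

lemma missing_edgeI_A: "x \<in> A \<Longrightarrow> y \<in> A \<Longrightarrow> x \<noteq> y \<Longrightarrow> \<not> E x y \<Longrightarrow> missing_edge x y"
  using A uv sym by (intro missing_edgeI[of v]) (auto simp: S_def)

lemma missing_edgeI_B: "x \<in> B \<Longrightarrow> y \<in> B \<Longrightarrow> x \<noteq> y \<Longrightarrow> \<not> E x y \<Longrightarrow> missing_edge x y"
  using B uv sym by (intro missing_edgeI[of u]) (auto simp: S_def)

text \<open>The only obstruction arises when \<open>A\<close> and \<open>B\<close> have the same size, the link of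
  \<open>{u, v} \<union> C\<close> is the boundary of a cross polytope on \<open>A \<union> B\<close>, and removing
  a vertex of \<open>C\<close> never gives a cone.\<close>

lemma matching_and_private_pairs:
  assumes nc: "\<not> collapsible (2 * k) (link_complex {u, v} (C \<union> (A \<union> B)))" and "C \<noteq> {}"
  shows "\<forall>x\<in>A \<union> B. \<not> missing_edge x x \<and> (\<exists>!y. y \<in> A \<union> B \<and> missing_edge x y)"
    and "w \<in> C \<Longrightarrow> \<exists>a\<in>A. \<exists>b\<in>B. \<not> E w a \<and> \<not> E w b \<and> \<not> E a b \<and>
      triple_free (S - {w} \<union> {a, b})"
proof -
  define p where "p = card A"
  \<comment> \<open>The innermost link has \<open>2 * p\<close> vertices and is
    \<open>p\<close>-collapsible, so the general bound \<open>p + card C\<close> exceeds the goal by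
    exactly one.\<close>
  have p: "card A = p" "card B = p" "p + card C = Suc (2 * k)"
    using collapsible_if_small nc card_AC card_BC p_def by linarith+
  have fin_AB: "finite (A \<union> B)" using fin by simp
  have S_AB: "(A \<union> B) \<inter> S = {}" "(A \<union> B) \<inter> (S - {w}) = {}" for w
    using uv disj by (auto simp: S_def)
  \<comment> \<open>Otherwise splitting off only \<open>C - {w}\<close> would give the bound
    \<open>p + (card C - 1)\<close>, which is \<open>2 * k\<close>.\<close>
  have insert: "\<not> collapsible p (link_complex (S - {w}) (insert w (A \<union> B)))" if "w \<in> C" for w
  proof
    assume *: "collapsible p (link_complex (S - {w}) (insert w (A \<union> B)))"
    have "S - {w} = {u, v} \<union> (C - {w})" using that uv by (auto simp: S_def)
    then have "collapsible (p + card (C - {w})) (link_complex {u, v} (insert w ((C - {w}) \<union> (A \<union> B))))"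
      using * that uv fin disj p card_AB AB
      by (intro collapsible_link_complex_Un_insert[of "C - {w}" u _ v]) auto
    moreover have "insert w ((C - {w}) \<union> (A \<union> B)) = C \<union> (A \<union> B)" using that by auto
    moreover have "p + card (C - {w}) = 2 * k"
      using p that fin by (simp add: card_Diff_singleton card_gt_0_iff) (metis Suc_pred add_Suc_right card_gt_0_iff diff_Suc_1 empty_iff)
    ultimately show False using nc by simp
  qed
  have del: "collapsible p (link_complex (S - {w}) (A \<union> B))" if "w \<in> C" for w
    using that uv AB fin_AB card_AB p S_AB by (intro collapsible_link_complex_flag[of u _ v]) (auto simp: S_def)
  have S_w: "insert w (S - {w}) = S" if "w \<in> C" for w
    using that by (auto simp: S_def)
  have w_AB: "w \<notin> A \<union> B" if "w \<in> C" for w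
    using that disj by blast
  \<comment> \<open>These are the link and the deletion of \<open>w\<close>; if they were equal,
    \<open>w\<close> would be the apex of a cone over a \<open>p\<close>-collapsible
    complex.\<close>
  have ncone: "link_complex S (A \<union> B) \<noteq> link_complex (S - {w}) (A \<union> B)" if "w \<in> C" for w
    using collapsible_link_complex_cone[of w "S - {w}" "A \<union> B" p] insert del S_w w_AB that by auto
  obtain w0 where w0: "w0 \<in> C" using \<open>C \<noteq> {}\<close> by blast
  have free: "triple_free S"
  proof (rule ccontr)
    assume "\<not> triple_free S"
    then have "link_complex S (A \<union> B) = {}" using triple_free_subset by (auto simp: link_complex_def)
    then have "link_complex (S - {w0}) (insert w0 (A \<union> B)) = link_complex (S - {w0}) (A \<union> B)"
      using link_complex_insert[OF w_AB[OF w0]] S_w[OF w0] by simp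
    then show False using insert[OF w0] del[OF w0] by simp
  qed
  have flag: "link_complex S (A \<union> B) = flag_complex missing_edge (A \<union> B)"
    using link_complex_eq_flag_complex[of u S v "A \<union> B"] uv AB S_AB free
    by (simp add: missing_edge_def[abs_def] S_def)
  show match: "\<forall>x\<in>A \<union> B. \<not> missing_edge x x \<and> (\<exists>!y. y \<in> A \<union> B \<and> missing_edge x y)"
  proof (cases p)
    case 0
    then show ?thesis using p fin by simp
  next
    case (Suc i)
    \<comment> \<open>Otherwise splitting off \<open>w0\<close> would contradict
      \<open>insert\<close>. The number of vertices is exactly \<open>2 * Suc i\<close>, the
      extremal case for flag complexes.\<close>
    have "\<not> collapsible i (link_complex S (A \<union> B))"
      using collapsible_link_complex_insert[of i w0 "S - {w0}" "A \<union> B"] insert del S_w w_AB w0 Suc by auto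
    moreover have "symp missing_edge" unfolding missing_edge_def[abs_def] by (rule symp_not_triple_free)
    ultimately show ?thesis
      using collapsible_flag_complex_or_matching[OF fin_AB, of i missing_edge] flag card_AB p Suc by simp
  qed
  assume w: "w \<in> C"
  have "link_complex S (A \<union> B) \<subseteq> link_complex (S - {w}) (A \<union> B)"
    by (auto simp: link_complex_def intro: triple_free_subset)
  then obtain U where U: "U \<subseteq> A \<union> B" "triple_free (S - {w} \<union> U)" "\<not> triple_free (S \<union> U)"
    using ncone[OF w] by (auto simp: link_complex_def)
  moreover have "S \<union> U = insert w (S - {w} \<union> U)" using S_w[OF w] by auto
  ultimately obtain x y where xy: "x \<in> S - {w} \<union> U" "y \<in> S - {w} \<union> U" "x \<noteq> y" "x \<noteq> w" "y \<noteq> w"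
    "\<not> E w x" "\<not> E w y" "\<not> E x y"
    by (metis not_triple_free_insertE)
  have wS: "w \<in> S" using w by (simp add: S_def)
  have P_self: "triple_free (insert z S)" if "z \<in> S \<union> U" for z
    using that match free U(1) by (cases "z \<in> S") (auto simp: missing_edge_def insert_absorb)
  \<comment> \<open>With \<open>x\<close> or \<open>y\<close> in \<open>S\<close>, the independent
    triple \<open>w, x, y\<close> would lie in \<open>S\<close> plus one vertex, which is
    triple-free by \<open>P_self\<close>.\<close>
  have *: "x \<notin> S" "y \<notin> S"
    using xy wS P_self[of x] P_self[of y] triple_freeD[of _ w x y] by blast+
  have mem: "x \<in> U" "y \<in> U" using xy * by auto
  \<comment> \<open>Two vertices of \<open>A\<close> would form an independent triple with
    \<open>v\<close>, and two of \<open>B\<close> one with \<open>u\<close>, inside the triple-free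
    set \<open>S - {w} \<union> U\<close>. So one vertex lies on each side.\<close>
  have "\<not> (x \<in> A \<and> y \<in> A)"
    using triple_freeD[OF U(2), of v x y] mem A[of x] A[of y] uv w xy by (auto simp: S_def)
  moreover have "\<not> (x \<in> B \<and> y \<in> B)"
    using triple_freeD[OF U(2), of u x y] mem B[of x] B[of y] uv w xy by (auto simp: S_def)
  moreover have "triple_free (S - {w} \<union> {x, y})"
    using U(2) mem by (auto intro: triple_free_subset)
  moreover have "triple_free (S - {w} \<union> {y, x})"
    using U(2) mem by (auto intro: triple_free_subset)
  moreover have "x \<in> A \<union> B" "y \<in> A \<union> B" using mem U(1) by auto
  moreover have "\<not> E y x" using xy sym by blast
  ultimately show "\<exists>a\<in>A. \<exists>b\<in>B. \<not> E w a \<and> \<not> E w b \<and> \<not> E a b \<and>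
      triple_free (S - {w} \<union> {a, b})"
    using xy(6-8) by blast
qed

text \<open>Add up the degrees of \<open>a\<close>, \<open>b\<close> and \<open>w\<close>. As
  \<open>a\<close> and \<open>b\<close> are each other's only partners, \<open>a\<close> is adjacent
  to the rest of \<open>A\<close> and to the vertices of \<open>B - {b}\<close> that
  \<open>w\<close> misses, and symmetrically for \<open>b\<close>. So what \<open>w\<close> loses in
  \<open>A \<union> B\<close> is gained at \<open>a\<close> or \<open>b\<close>. In the same way
  every vertex of \<open>C - {w}\<close> is adjacent to \<open>a\<close> or \<open>b\<close>, and to
  both if \<open>w\<close> misses it.\<close>

lemma card_sum_le_of_matching:
  assumes match: "\<forall>x\<in>A \<union> B. \<not> missing_edge x x \<and> (\<exists>!y. y \<in> A \<union> B \<and> missing_edge x y)"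
    and w: "w \<in> C" and a: "a \<in> A" and b: "b \<in> B"
    and nadj: "\<not> E w a" "\<not> E w b" "\<not> E a b" and free: "triple_free (S - {w} \<union> {a, b})"
  shows "card A + card B + card C \<le> 3 * k + 2"
proof -
  let ?T = "{u, v} \<union> A \<union> B \<union> C"
  define DA DB where "DA = {x \<in> A. \<not> E w x}" and "DB = {x \<in> B. \<not> E w x}"
  define F where "F = {x \<in> C - {w}. \<not> E w x}"
  define Ca Cb where "Ca = {x \<in> C - {w}. E a x}" and "Cb = {x \<in> C - {w}. E b x}"
  have fins: "finite DA" "finite DB" "finite F" "finite Ca" "finite Cb"
    using fin by (auto simp: DA_def DB_def F_def Ca_def Cb_def)
  have neq: "a \<noteq> b" "w \<noteq> a" "w \<noteq> b" using a b w disj by auto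
  have wS: "w \<in> S" using w by (simp add: S_def)
  have Pab: "missing_edge a b" "missing_edge b a" using wS nadj neq sym by (auto intro: missing_edgeI[of w])
  have Pa: "y = b" if "missing_edge a y" "y \<in> A \<union> B" for y using match Pab that a b by blast
  have Pb: "y = a" if "missing_edge b y" "y \<in> A \<union> B" for y using match Pab that a b by blast
  have free': "triple_free (insert x S)" if "x \<in> A \<union> B" for x
    using match that by (auto simp: missing_edge_def)
  have aA: "E a x" if "x \<in> A - {a}" for x
    using that a b missing_edgeI_A[of a x] Pa[of x] disj by blast
  have bB: "E b x" if "x \<in> B - {b}" for x
    using that a b missing_edgeI_B[of b x] Pb[of x] disj by blast
  have aD: "E a x" if "x \<in> DB - {b}" for x
    using that a b w wS missing_edgeI[of w a x] Pa[of x] disj nadj sym neq unfolding DB_def by blast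
  have bD: "E b x" if "x \<in> DA - {a}" for x
    using that a b w wS missing_edgeI[of w b x] Pb[of x] disj nadj sym neq unfolding DA_def by blast
  have "card ({u} \<union> (A - {a}) \<union> (DB - {b}) \<union> Ca) \<le> card {y \<in> ?T. E a y}"
    using aA aD A(1)[OF a] sym fin by (intro card_mono) (auto simp: Ca_def DB_def)
  also have "card ({u} \<union> (A - {a}) \<union> (DB - {b}) \<union> Ca) = 1 + card (A - {a}) + card (DB - {b}) + card Ca"
    using uv disj fin fins by (subst card_Un_disjoint; auto simp: DB_def Ca_def)+
  finally have dega: "card A + card (DB - {b}) + card Ca \<le> Suc (2 * k)"
    using degree[of a] a fin card_Suc_Diff1[of A a] by simp
  have "card ({v} \<union> (B - {b}) \<union> (DA - {a}) \<union> Cb) \<le> card {y \<in> ?T. E b y}"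
    using bB bD B(1)[OF b] sym fin by (intro card_mono) (auto simp: Cb_def DA_def)
  also have "card ({v} \<union> (B - {b}) \<union> (DA - {a}) \<union> Cb) = 1 + card (B - {b}) + card (DA - {a}) + card Cb"
    using uv disj fin fins by (subst card_Un_disjoint; auto simp: DA_def Cb_def)+
  finally have degb: "card B + card (DA - {a}) + card Cb \<le> Suc (2 * k)"
    using degree[of b] b fin card_Suc_Diff1[of B b] by simp
  have D: "card DA = Suc (card (DA - {a}))" "card DB = Suc (card (DB - {b}))"
    using a b nadj fins card_Suc_Diff1[of DA a] card_Suc_Diff1[of DB b] by (auto simp: DA_def DB_def)
  \<comment> \<open>Here it matters that \<open>{a, b}\<close> is a face of the link of
    \<open>S - {w}\<close>: its non-adjacency is harmful only because of \<open>w\<close>.\<close>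
  have "C - {w} \<subseteq> Ca \<union> Cb"
  proof
    fix x assume x: "x \<in> C - {w}"
    then have "E a b \<or> E b x \<or> E a x"
      using a b neq disj by (intro triple_freeD[OF free]) (auto simp: S_def)
    then show "x \<in> Ca \<union> Cb" using x nadj by (auto simp: Ca_def Cb_def)
  qed
  then have "card C - 1 \<le> card (Ca \<union> Cb)"
    using card_mono[of "Ca \<union> Cb" "C - {w}"] fins w by simp
  moreover have "F \<subseteq> Ca \<inter> Cb"
  proof
    fix x assume x: "x \<in> F"
    then have "E w x \<or> E x a \<or> E w a" "E w x \<or> E x b \<or> E w b"
      using triple_freeD[OF free'[of a], of w x a] triple_freeD[OF free'[of b], of w x b]
        a b neq disj w by (auto simp: S_def F_def)
    then show "x \<in> Ca \<inter> Cb" using x nadj sym by (auto simp: F_def Ca_def Cb_def)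
  qed
  then have "card F \<le> card (Ca \<inter> Cb)" using fins by (intro card_mono) auto
  ultimately have Cab: "card C - 1 + card F \<le> card Ca + card Cb"
    using card_Un_Int[of Ca Cb] fins by simp
  have "card ({u, v} \<union> (A - DA) \<union> (B - DB) \<union> (C - {w} - F)) \<le> card {y \<in> ?T. E w y}"
    using C[OF w] sym fin by (intro card_mono) (auto simp: DA_def DB_def F_def)
  also have "card ({u, v} \<union> (A - DA) \<union> (B - DB) \<union> (C - {w} - F)) =
      2 + card (A - DA) + card (B - DB) + card (C - {w} - F)"
    using uv disj fin fins by (subst card_Un_disjoint; auto)+
  also have "card (A - DA) = card A - card DA" using fins by (intro card_Diff_subset) (auto simp: DA_def)
  also have "card (B - DB) = card B - card DB" using fins by (intro card_Diff_subset) (auto simp: DB_def)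
  also have "card (C - {w} - F) = card (C - {w}) - card F" using fins by (intro card_Diff_subset) (auto simp: F_def)
  also have "card (C - {w}) = card C - 1" using w by simp
  finally have degw: "2 + (card A - card DA) + (card B - card DB) + (card C - 1 - card F) \<le> Suc (2 * k)"
    using degree[of w] w by simp
  have le: "card DA \<le> card A" "card DB \<le> card B" using fin by (auto intro!: card_mono simp: DA_def DB_def)
  have "card C \<ge> 1" using w fin by (simp add: Suc_le_eq card_gt_0_iff) blast
  \<comment> \<open>The sum gives \<open>2 * (card A + card B + card C) - 2 \<le> 6 * k + 3\<close>;
    the left side is even, so 6k + 2 is also a bound.\<close>
  then show ?thesis
    using dega degb degw D Cab le
    by (simp add: nat_diff_split)
qed

text \<open>If the bound fails, each \<open>w\<close> in \<open>C\<close> has its own partnered pair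
  \<open>\<alpha> w\<close>, \<open>\<beta> w\<close> across \<open>A\<close> and \<open>B\<close>.
  Non-adjacent vertices of \<open>A\<close> are partners of each other, hence not of the form
  \<open>\<alpha> w\<close>, and then \<open>A\<close> would be too large compared with
  \<open>C\<close>. The independent triple is kept in the conclusion because it supplies a better
  choice of \<open>v\<close> later.\<close>

lemma collapsible_or_clique:
  "collapsible (2 * k) (link_complex {u, v} (C \<union> (A \<union> B))) \<or>
    (\<forall>x\<in>A. \<forall>y\<in>A. x \<noteq> y \<longrightarrow> E x y) \<and>
    (\<exists>w\<in>C. \<exists>a\<in>A. \<exists>b\<in>B. \<not> E w a \<and> \<not> E w b \<and> \<not> E a b)"
proof (rule disj_imp[THEN iffD2], rule impI)
  assume nc: "\<not> collapsible (2 * k) (link_complex {u, v} (C \<union> (A \<union> B)))"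
  then have "C \<noteq> {}" using collapsible_if_no_common_neighbours by blast
  then obtain w0 where w0: "w0 \<in> C" by blast
  have card: "card A = card B" "card A + card C = Suc (2 * k)"
    using collapsible_if_small nc card_AC card_BC by linarith+
  note match = matching_and_private_pairs(1)[OF nc \<open>C \<noteq> {}\<close>]
  obtain \<alpha> \<beta> where ab: "\<And>w. w \<in> C \<Longrightarrow> \<alpha> w \<in> A \<and> \<beta> w \<in> B \<and> \<not> E w (\<alpha> w) \<and> \<not> E w (\<beta> w) \<and>
      \<not> E (\<alpha> w) (\<beta> w) \<and> triple_free (S - {w} \<union> {\<alpha> w, \<beta> w})"
    using matching_and_private_pairs(2)[OF nc \<open>C \<noteq> {}\<close>] by metis
  have missing: "missing_edge (\<alpha> w) (\<beta> w)" if "w \<in> C" for w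
    using ab[OF that] that disj sym by (intro missing_edgeI[of w]) (auto simp: S_def)
  have uniq: "y = z" if "x \<in> A \<union> B" "y \<in> A \<union> B" "z \<in> A \<union> B" "missing_edge x y" "missing_edge x z" for x y z
    using match that by blast
  \<comment> \<open>If \<open>w\<close> and \<open>w'\<close> shared \<open>\<alpha>\<close>, they
    would share the unique partner \<open>\<beta>\<close>, and \<open>w'\<close> with this pair
    would be an independent triple in the triple-free set belonging to \<open>w\<close>.\<close>
  have inj: "inj_on \<alpha> C"
  proof (rule inj_onI, rule ccontr)
    fix w w' assume w: "w \<in> C" "w' \<in> C" "\<alpha> w = \<alpha> w'" "w \<noteq> w'"
    then have "\<beta> w = \<beta> w'" using uniq[of "\<alpha> w"] missing ab by (metis UnCI)
    moreover have "\<alpha> w' \<noteq> \<beta> w'" "\<alpha> w' \<noteq> w'" "\<beta> w' \<noteq> w'"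
      using ab[OF w(2)] w(2) disj by (auto simp: disjoint_iff)
    ultimately show False
      using triple_freeD[of "S - {w} \<union> {\<alpha> w, \<beta> w}" w' "\<alpha> w" "\<beta> w"] ab[OF w(1)] ab[OF w(2)] w
      by (auto simp: S_def)
  qed
  have "card A + card B + card C \<le> 3 * k + 2"
    using ab[OF w0] by (intro card_sum_le_of_matching[OF match w0, of "\<alpha> w0" "\<beta> w0"]) auto
  \<comment> \<open>Subtracting \<open>card A + card C = 2 * k + 1\<close> leaves
    \<open>card A \<le> k + 1\<close>, hence \<open>card C \<ge> k\<close>.\<close>
  then have le: "card A \<le> card C + 1" using card by presburger
  have "E x y" if xy: "x \<in> A" "y \<in> A" "x \<noteq> y" for x y
  proof (rule ccontr)
    assume n: "\<not> E x y"
    have "missing_edge x y" "missing_edge y x" using missing_edgeI_A xy n sym by blast+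
    then have "\<alpha> w \<noteq> x \<and> \<alpha> w \<noteq> y" if "w \<in> C" for w
      using ab[OF that] missing[OF that] uniq[of "\<alpha> w" "\<beta> w"] xy disj by blast
    then have "\<alpha> ` C \<subseteq> A - {x, y}" using ab by blast
    then have "card C \<le> card (A - {x, y})" using inj fin by (metis card_image card_mono finite_Diff)
    also have "\<dots> = card A - 2" using xy by (subst card_Diff_subset) auto
    finally have "card C \<le> card A - 2" .
    moreover have "card C \<ge> 1" using w0 fin by (simp add: Suc_le_eq card_gt_0_iff) blast
    ultimately show False using le by linarith
  qed
  then show "(\<forall>x\<in>A. \<forall>y\<in>A. x \<noteq> y \<longrightarrow> E x y) \<and>
    (\<exists>w\<in>C. \<exists>a\<in>A. \<exists>b\<in>B. \<not> E w a \<and> \<not> E w b \<and> \<not> E a b)"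
    using ab[OF w0] w0 by blast
qed

end

section \<open>From the links of non-edges to the links of vertices and the whole complex\<close>

context symmetric_relation
begin

lemma collapsible_link_complex_pair_or_clique:
  assumes "finite V" "u \<in> V" "v \<in> V" "u \<noteq> v" "\<not> E u v"
    "\<And>x. x \<in> V \<Longrightarrow> card {y \<in> V. E x y} \<le> Suc (2 * k)"
  defines "X \<equiv> V - {u, v}"
  shows "collapsible (2 * k) (link_complex {u, v} X) \<or>
    (\<forall>x\<in>X. \<forall>y\<in>X. E u x \<and> \<not> E v x \<and> E u y \<and> \<not> E v y \<and> x \<noteq> y \<longrightarrow> E x y) \<and>
    (\<exists>w\<in>X. \<exists>a\<in>X. \<exists>b\<in>X. E u w \<and> E v w \<and> E u a \<and> \<not> E v a \<and> \<not> E u b \<and> E v b \<and>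
      \<not> E w a \<and> \<not> E w b \<and> \<not> E a b)"
proof -
  define A where "A = {x \<in> X. E u x \<and> \<not> E v x}"
  define B where "B = {x \<in> X. E v x \<and> \<not> E u x}"
  define C where "C = {x \<in> X. E u x \<and> E v x}"
  have T: "{u, v} \<union> A \<union> B \<union> C \<subseteq> V" using assms by (auto simp: A_def B_def C_def)
  interpret nonadjacent_pair E u v A B C k
  proof
    fix x assume x: "x \<in> {u, v} \<union> A \<union> B \<union> C"
    have "card {y \<in> {u, v} \<union> A \<union> B \<union> C. E x y} \<le> card {y \<in> V. E x y}"
      using T assms(1) by (intro card_mono) auto
    then show "card {y \<in> {u, v} \<union> A \<union> B \<union> C. E x y} \<le> Suc (2 * k)"
      using assms(6)[of x] x T by (meson le_trans subsetD)
  qed (use assms in \<open>auto simp: A_def B_def C_def\<close>)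
  \<comment> \<open>A vertex adjacent to neither \<open>u\<close> nor \<open>v\<close> forms an
    independent triple with them, so it is in no face of the link.\<close>
  have K_eq: "link_complex {u, v} X = link_complex {u, v} (C \<union> (A \<union> B))"
  proof
    show "link_complex {u, v} X \<subseteq> link_complex {u, v} (C \<union> (A \<union> B))"
    proof
      fix U assume U: "U \<in> link_complex {u, v} X"
      have "x \<in> C \<union> (A \<union> B)" if "x \<in> U" for x
      proof -
        have "x \<in> X" "triple_free ({u, v} \<union> U)" using U that by (auto simp: link_complex_def)
        then have "E u v \<or> E v x \<or> E u x"
          using that assms(4) by (intro triple_freeD[of "{u, v} \<union> U"]) (auto simp: X_def)
        then show ?thesis using \<open>x \<in> X\<close> assms(5) by (auto simp: A_def B_def C_def)
      qed
      then show "U \<in> link_complex {u, v} (C \<union> (A \<union> B))" using U by (auto simp: link_complex_def)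
    qed
  qed (auto simp: link_complex_def A_def B_def C_def)
  consider "collapsible (2 * k) (link_complex {u, v} (C \<union> (A \<union> B)))"
    | "\<forall>x\<in>A. \<forall>y\<in>A. x \<noteq> y \<longrightarrow> E x y" "\<exists>w\<in>C. \<exists>a\<in>A. \<exists>b\<in>B. \<not> E w a \<and> \<not> E w b \<and> \<not> E a b"
    using collapsible_or_clique by blast
  then show ?thesis
  proof cases
    case 1
    then show ?thesis using K_eq by simp
  next
    case 2
    then show ?thesis unfolding A_def B_def C_def by blast
  qed
qed

text \<open>If a non-neighbour \<open>v\<close> of \<open>u\<close> fails, the independent triple \<open>w, a, b\<close> it provides shows
  that \<open>b\<close> works: \<open>w\<close> and \<open>a\<close> are non-adjacent neighbours of \<open>u\<close> outside the neighbourhood of \<open>b\<close>.\<close>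

lemma exists_collapsible_pair:
  assumes "finite V" "u \<in> V" "v \<in> V" "u \<noteq> v" "\<not> E u v"
    "\<And>x. x \<in> V \<Longrightarrow> card {y \<in> V. E x y} \<le> Suc (2 * k)"
  shows "\<exists>v\<in>V - {u}. \<not> E u v \<and> collapsible (2 * k) (link_complex {u, v} (V - {u, v}))"
proof (cases "collapsible (2 * k) (link_complex {u, v} (V - {u, v}))")
  case True
  then show ?thesis using assms by blast
next
  case False
  then obtain w a b where wab: "w \<in> V - {u, v}" "a \<in> V - {u, v}" "b \<in> V - {u, v}"
    "E u w" "E v w" "E u a" "\<not> E v a" "\<not> E u b" "E v b" "\<not> E w a" "\<not> E w b" "\<not> E a b"
    using collapsible_link_complex_pair_or_clique[OF assms] by blast
  have "w \<in> V - {u, b}" "a \<in> V - {u, b}" "\<not> E b w" "\<not> E b a" "w \<noteq> a"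
    using wab sym by auto
  moreover have "b \<in> V" "u \<noteq> b" using wab by auto
  ultimately have "collapsible (2 * k) (link_complex {u, b} (V - {u, b}))"
    using collapsible_link_complex_pair_or_clique[OF assms(1,2) \<open>b \<in> V\<close> \<open>u \<noteq> b\<close> wab(8) assms(6)] wab by blast
  then show ?thesis using wab by blast
qed

text \<open>Non-neighbours of \<open>u\<close> are split off, with a good \<open>v\<close> chosen
  anew in each smaller vertex set; the degree bound passes to subsets. When only neighbours of
  \<open>u\<close> remain, there are at most 2k + 1 of them, and the size of the faces is bound
  enough.\<close>

lemma collapsible_link_complex_singleton:
  assumes "finite V" "u \<in> V" "\<And>x. x \<in> V \<Longrightarrow> card {y \<in> V. E x y} \<le> Suc (2 * k)"
  shows "collapsible (Suc (2 * k)) (link_complex {u} (V - {u}))"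
  using assms
proof (induction V rule: finite_psubset_induct)
  case (psubset V)
  show ?case
  proof (cases "\<exists>v\<in>V. v \<noteq> u \<and> \<not> E u v")
    case False
    then have "card (V - {u}) \<le> card {y \<in> V. E u y}"
      using psubset.hyps by (intro card_mono) auto
    also have "\<dots> \<le> Suc (2 * k)" using psubset.prems by blast
    finally show ?thesis
      using psubset.hyps
      by (intro collapsible_mono[OF collapsible_card[of "V - {u}"]]) (auto simp: link_complex_def)
  next
    case True
    then obtain v where v: "v \<in> V" "v \<noteq> u" "collapsible (2 * k) (link_complex {u, v} (V - {u, v}))"
      using exists_collapsible_pair[OF psubset.hyps psubset.prems(1) _ _ _ psubset.prems(2)] by blast
    have "card {y \<in> V - {v}. E x y} \<le> Suc (2 * k)" if "x \<in> V - {v}" for x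
    proof -
      have "card {y \<in> V - {v}. E x y} \<le> card {y \<in> V. E x y}"
        using psubset.hyps by (intro card_mono) auto
      then show ?thesis using psubset.prems(2)[of x] that by simp
    qed
    then have "collapsible (Suc (2 * k)) (link_complex {u} (V - {v} - {u}))"
      using v psubset.prems by (intro psubset.IH) auto
    moreover have "V - {v} - {u} = V - {u, v}" by auto
    ultimately have "collapsible (Suc (2 * k)) (link_complex {u} (insert v (V - {u, v})))"
      using v by (intro collapsible_link_complex_insert) (auto simp: insert_commute)
    moreover have "insert v (V - {u, v}) = V - {u}" using v by auto
    ultimately show ?thesis by simp
  qed
qed

lemma collapsible_link_complex_empty:
  assumes "finite V" "\<And>x. x \<in> V \<Longrightarrow> card {y \<in> V. E x y} \<le> Suc (2 * k)"
  shows "collapsible (2 * k + 2) (link_complex {} V)"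
  using assms
proof (induction V rule: finite_induct)
  case empty
  show ?case by (intro collapsible_mono[OF collapsible_card[of "{}"]]) (auto simp: link_complex_def)
next
  case (insert u V)
  have "card {y \<in> V. E x y} \<le> Suc (2 * k)" if "x \<in> V" for x
  proof -
    have "card {y \<in> V. E x y} \<le> card {y \<in> insert u V. E x y}"
      using insert.hyps by (intro card_mono) auto
    then show ?thesis using insert.prems[of x] that by simp
  qed
  then have "collapsible (Suc (Suc (2 * k))) (link_complex {} V)" using insert.IH by simp
  moreover have "collapsible (Suc (2 * k)) (link_complex {u} V)"
    using collapsible_link_complex_singleton[of "insert u V" u k] insert by simp
  ultimately show ?case using collapsible_link_complex_insert[of "Suc (2 * k)" u "{}" V] insert.hyps by simp
qed

end

section \<open>Graphs of bounded degree\<close>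

context graph
begin

lemma symmetric_relation_dominates: "symmetric_relation (\<lambda>x y. x \<rightarrow>\<^bsub>G\<^esub> y)"
  by unfold_locales (use sym_arcs in \<open>auto simp: symmetric_def dest: symD\<close>)

interpretation dominates: symmetric_relation "\<lambda>x y. x \<rightarrow>\<^bsub>G\<^esub> y"
  by (rule symmetric_relation_dominates)

lemma card_dominated_le_out_degree: "card {y \<in> verts G. x \<rightarrow>\<^bsub>G\<^esub> y} \<le> out_degree G x"
proof -
  have "{y \<in> verts G. x \<rightarrow>\<^bsub>G\<^esub> y} \<subseteq> head G ` out_arcs G x"
    by (auto simp: arcs_ends_conv)
  then have "card {y \<in> verts G. x \<rightarrow>\<^bsub>G\<^esub> y} \<le> card (head G ` out_arcs G x)"
    by (intro card_mono) auto
  also have "\<dots> \<le> card (out_arcs G x)" by (intro card_image_le) auto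
  finally show ?thesis by (simp add: out_degree_def)
qed

lemma independence_number_less_3_iff:
  assumes "U \<subseteq> verts G"
  shows "independence_number (G \<restriction> U) < 3 \<longleftrightarrow> dominates.triple_free U"
proof -
  have adj: "x \<rightarrow>\<^bsub>G \<restriction> U\<^esub> y \<longleftrightarrow> x \<rightarrow>\<^bsub>G\<^esub> y" if "x \<in> U" "y \<in> U" for x y
    using that by (auto simp: arcs_ends_conv)
  have indep: "indep_set (G \<restriction> U) S \<longleftrightarrow> S \<subseteq> U \<and> (\<forall>u\<in>S. \<forall>v\<in>S. \<not> u \<rightarrow>\<^bsub>G\<^esub> v)" for S
    using adj by (auto simp: indep_set_def subset_eq)
  have "finite U" using finite_subset[OF assms] by simp
  then have "finite {S. indep_set (G \<restriction> U) S}" by (simp add: finite_indep_sets)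
  moreover have "indep_set (G \<restriction> U) {}" by (simp add: indep_set_def)
  ultimately have "independence_number (G \<restriction> U) < 3 \<longleftrightarrow> (\<forall>S. indep_set (G \<restriction> U) S \<longrightarrow> card S < 3)"
    unfolding independence_number_def by (subst Max_less_iff) auto
  also have "\<dots> \<longleftrightarrow> dominates.triple_free U"
  proof
    assume L: "\<forall>S. indep_set (G \<restriction> U) S \<longrightarrow> card S < 3"
    show "dominates.triple_free U"
      unfolding dominates.triple_free_def
    proof (intro ballI impI, rule ccontr)
      fix x y z assume *: "x \<in> U" "y \<in> U" "z \<in> U" "x \<noteq> y \<and> y \<noteq> z \<and> x \<noteq> z"
        "\<not> (x \<rightarrow>\<^bsub>G\<^esub> y \<or> y \<rightarrow>\<^bsub>G\<^esub> z \<or> x \<rightarrow>\<^bsub>G\<^esub> z)"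
      \<comment> \<open>\<open>indep_set\<close> also tests a vertex against itself, unlike
        \<open>triple_free\<close>; the absence of loops settles these cases.\<close>
      then have "indep_set (G \<restriction> U) {x, y, z}"
        using dominates.sym adj_not_same by (auto simp: indep)
      then show False using L * by auto
    qed
  next
    assume R: "dominates.triple_free U"
    show "\<forall>S. indep_set (G \<restriction> U) S \<longrightarrow> card S < 3"
    proof (intro allI impI, rule ccontr)
      fix S assume S: "indep_set (G \<restriction> U) S" "\<not> card S < 3"
      then obtain T where "T \<subseteq> S" "card T = 3" using obtain_subset_with_card_n[of 3 S] by auto
      then obtain x y z where "x \<in> S" "y \<in> S" "z \<in> S" "x \<noteq> y" "y \<noteq> z" "x \<noteq> z"
        by (auto simp: card_3_iff)
      then show False
        using dominates.triple_freeD[OF R, of x y z] S(1) by (auto simp: indep)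
    qed
  qed
  finally show ?thesis .
qed

lemma indep_complex_3_collapsible:
  assumes "max_degree G \<le> Suc (2 * k)"
  shows "collapsible (2 * k + 2) (indep_complex 3 G)"
proof -
  have "card {y \<in> verts G. x \<rightarrow>\<^bsub>G\<^esub> y} \<le> Suc (2 * k)" if "x \<in> verts G" for x
  proof -
    have "out_degree G x \<le> max_degree G"
      unfolding max_degree_def using that by (intro Max_ge) auto
    then show ?thesis using card_dominated_le_out_degree[of x] assms by linarith
  qed
  moreover have "indep_complex 3 G = dominates.link_complex {} (verts G)"
    using independence_number_less_3_iff by (auto simp: indep_complex_def dominates.link_complex_def)
  ultimately show ?thesis using dominates.collapsible_link_complex_empty[of "verts G" k] by simp
qed

end

theorem theorem1p8:
  fixes G :: "('a, 'b) pre_digraph" and \<Delta> :: nat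
  assumes "graph G"
    and "max_degree G \<le> \<Delta>"
  shows "(even \<Delta> \<longrightarrow> collapsibility (indep_complex 3 G) \<le> \<Delta> + 2) \<and>
         (odd \<Delta> \<longrightarrow> collapsibility (indep_complex 3 G) \<le> \<Delta> + 1)"
proof -
  \<comment> \<open>With k = \<open>\<Delta> div 2\<close>, the degrees are at most 2k + 1 for
    either parity, and 2k + 2 is \<open>\<Delta> + 2\<close> or \<open>\<Delta> + 1\<close>
    accordingly.\<close>
  have "collapsibility (indep_complex 3 G) \<le> 2 * (\<Delta> div 2) + 2"
    unfolding collapsibility_def
    using graph.indep_complex_3_collapsible[OF assms(1), of "\<Delta> div 2"] assms(2)
    by (intro Least_le) linarith
  then show ?thesis by presburger
qed

end
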